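(* Let $G=(\mathcal{V},\mathcal{E})$ be an original graph, that is, a finite directed rooted tree with root $r$, edges directed towards the root, and a representation vector $h_v^*\in\mathbb{R}^{k'}$ at each node $v\in\mathcal{V}$. Let $G'=(\mathcal{V}',\mathcal{E}')$ be an arbitrary hyper-structure graph with $\mathcal{V}'\subseteq\mathcal{V}$. Then for any graph neural network $f$ used to encode $G'$, there exists a set of SSAgg parameters $\theta$ such that $$\mathrm{SSAgg}_{\theta}(G)=h_r'=f(\mathcal{V}',\mathcal{E}'),$$ where $\mathrm{SSAgg}_\theta(G)=h_r'$ denotes the enhanced root representation generated by SSAgg on $G$ with parameters $\theta$.
   Context: Original graph. The nodes of $G$ are the attributes and timestamped records of an entity. Edges go from sub-attributes to their parent attribute and from each record of a dynamic attribute to the next record; a parent attribute is joined to a dynamic sub-attribute only through its most recent record. A root node $r$ receives an edge from each top-level attribute node. Thus $G$ is a tree with all edges directed towards $r$, and at least one node has an edge to $r$. Its adjacency matrix is $\mathbf{A}'$, with $\mathbf{A}'(i,j)=1$ iff there is a directed edge from $v_i$ to $v_j$. Each node $v_i$ carries a given representation (row) vector $h_i^*\in\mathbb{R}^{k'}$. SSAgg (Selective Semantic Aggregation). Given a real hyperparameter $\lambda$, its parameters $\theta=(\psi,\mathbf{W}')$ consist of a scoring function $\psi:\mathbb{R}^{k'}\times\mathbb{R}^{k'}\to\mathbb{R}$ and a matrix $\mathbf{W}'$ with $k'$ rows. It computes $$m_{i,j}=\psi(h_i^*,h_j^* )\ \text{ for } \mathbf{A}'(i,j)=1,\qquad \beta_{i,j}=\frac{\exp(m_{i,j})}{\exp(\lambda)+\sum_{k:\,\mathbf{A}'(k,j)=1}\exp(m_{k,j})},\qquad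 h_j'=\sum_{i:\,\mathbf{A}'(i,j)=1}\beta_{i,j}\,h_i^*\mathbf{W}'.$$ The output is $\mathrm{SSAgg}_\theta(G)=h_r'$, the vector at the root $r$. Hyper-structure graph. A hyper-structure graph is a graph $G'=(\mathcal{V}',\mathcal{E}')$ whose (nonempty) node set is a subset of $\mathcal{V}$ and whose edge set $\mathcal{E}'$ is an arbitrary set of connections between nodes of $\mathcal{V}'$ (not necessarily edges of $G$); each node $v\in\mathcal{V}'$ has input feature $h_v^*$. A graph neural network $f$ encodes $G'$ into a single vector $h_{G'}=f(\mathcal{V}',\mathcal{E}')$, computed from these node features and the edges (message passing followed by a pooling of the node representations). The output dimension of $f$ is the number of columns of $\mathbf{W}'$.
   Formalization: The formal theorem additionally assumes that some node with an edge to the root r has a nonzero representation vector; otherwise h_r' is 0 for every choice of parameters, while f(V',E') may be nonzero. *)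

theory Defs
  imports "HOL-Analysis.Analysis" "HOL-Library.Multiset" "Graph_Theory.Pair_Digraph"
begin

(* A rooted tree with all edges directed towards r: every node has exactly one directed
   walk to r.  Here pair_digraph is a finite digraph without loops or parallel edges; its
   arc set parcs G is the relation A'(i,j) = 1.  The root has at least one incoming edge. *)
definition original_graph :: "'v pair_pre_digraph \<Rightarrow> 'v \<Rightarrow> bool" where
  "original_graph G r \<longleftrightarrow>
     pair_digraph G \<and> r \<in> pverts G \<and>
     (\<forall>v\<in>pverts G. \<exists>!p. pre_digraph.awalk (with_proj G) v p r) \<and>
     (\<exists>i. (i, r) \<in> parcs G)"

(* The edges of G' are unrelated to those of G; an undirected edge is a pair of opposite arcs. *)
definition hyper_structure_graph :: "'v pair_pre_digraph \<Rightarrow> 'v pair_pre_digraph \<Rightarrow> bool" where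
  "hyper_structure_graph G G' \<longleftrightarrow>
     pair_wf_digraph G' \<and> pverts G' \<noteq> {} \<and> pverts G' \<subseteq> pverts G"

definition ssagg_score ::
  "(real^'k \<Rightarrow> real^'k \<Rightarrow> real) \<Rightarrow> ('v \<Rightarrow> real^'k) \<Rightarrow> 'v \<Rightarrow> 'v \<Rightarrow> real" where
  "ssagg_score \<psi> h i j = \<psi> (h i) (h j)"

definition ssagg_coeff ::
  "real \<Rightarrow> (real^'k \<Rightarrow> real^'k \<Rightarrow> real) \<Rightarrow> 'v pair_pre_digraph \<Rightarrow> ('v \<Rightarrow> real^'k) \<Rightarrow> 'v \<Rightarrow> 'v \<Rightarrow> real"
  where
  "ssagg_coeff lam \<psi> G h i j =
     exp (ssagg_score \<psi> h i j) /
       (exp lam + (\<Sum>k | (k, j) \<in> parcs G. exp (ssagg_score \<psi> h k j)))"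

(* W has CARD('k) rows and CARD('d) columns; x v* W is the row vector x times W. *)
definition ssagg_node ::
  "real \<Rightarrow> (real^'k \<Rightarrow> real^'k \<Rightarrow> real) \<Rightarrow> (real^'d^'k) \<Rightarrow> 'v pair_pre_digraph \<Rightarrow>
   ('v \<Rightarrow> real^'k) \<Rightarrow> 'v \<Rightarrow> real^'d"
  where
  "ssagg_node lam \<psi> W G h j =
     (\<Sum>i | (i, j) \<in> parcs G. ssagg_coeff lam \<psi> G h i j *\<^sub>R (h i v* W))"

(* Pitfall: the output at r is a combination of the vectors of the children of r, so it is 0
   for every choice of parameters when all these vectors are 0. *)
definition SSAgg ::
  "real \<Rightarrow> (real^'k \<Rightarrow> real^'k \<Rightarrow> real) \<times> (real^'d^'k) \<Rightarrow> 'v pair_pre_digraph \<Rightarrow>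
   ('v \<Rightarrow> real^'k) \<Rightarrow> 'v \<Rightarrow> real^'d"
  where
  "SSAgg lam \<theta> G h r = ssagg_node lam (fst \<theta>) (snd \<theta>) G h r"

(* A message-passing network with gnn_depth layers, followed by a pooling.  Node states and
   messages live in arbitrary types 'h and 'm, which covers layers of different widths.
   gnn_update does the permutation-invariant aggregation of the multiset of incoming messages
   together with its combination with the node's own state. *)
record ('k, 'h, 'm, 'd) gnn =
  gnn_depth :: nat
  gnn_init :: "real^'k \<Rightarrow> 'h"
  gnn_message :: "nat \<Rightarrow> 'h \<Rightarrow> 'h \<Rightarrow> 'm"
  gnn_update :: "nat \<Rightarrow> 'h \<Rightarrow> 'm multiset \<Rightarrow> 'h"
  gnn_pool :: "'h multiset \<Rightarrow> real^'d"

primrec gnn_state ::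
  "('k::finite, 'h, 'm, 'd::finite) gnn \<Rightarrow> 'v pair_pre_digraph \<Rightarrow> ('v \<Rightarrow> real^'k) \<Rightarrow> nat \<Rightarrow> 'v \<Rightarrow> 'h"
  where
  "gnn_state f G' h 0 v = gnn_init f (h v)"
| "gnn_state f G' h (Suc l) v =
     gnn_update f l (gnn_state f G' h l v)
       (image_mset (\<lambda>u. gnn_message f l (gnn_state f G' h l u) (gnn_state f G' h l v))
         (mset_set {u. (u, v) \<in> parcs G'}))"

definition gnn_encode ::
  "('k::finite, 'h, 'm, 'd::finite) gnn \<Rightarrow> 'v pair_pre_digraph \<Rightarrow> ('v \<Rightarrow> real^'k) \<Rightarrow> real^'d" where
  "gnn_encode f G' h =
     gnn_pool f (image_mset (gnn_state f G' h (gnn_depth f)) (mset_set (pverts G')))"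

end

theory Submission
  imports Defs
begin

text \<open>
  The output at the root is \<open>s v* W\<close>, where \<open>s\<close> is the attention-weighted sum of the vectors of the
  children of the root. As \<open>W\<close> is free, every target vector is reached once \<open>s \<noteq> 0\<close>. Fix a child
  with vector \<open>u \<noteq> 0\<close> and put \<open>a i = h i \<bullet> u\<close>. For the scores \<open>0\<close> and \<open>a i\<close>, the number \<open>s \<bullet> u\<close> is a
  positive multiple of \<open>\<Sum>i. a i\<close> and of \<open>\<Sum>i. exp (a i) * a i\<close> respectively. The second sum exceeds
  the first strictly, so one of the two scores gives \<open>s \<noteq> 0\<close>.
\<close>

text \<open>The factors \<open>exp a - 1\<close> and \<open>a\<close> never have opposite
  signs.\<close>

lemma exp_mult_self_ge: "exp a * a \<ge> (a::real)"
  using mult_nonneg_nonneg[of "exp a - 1" a] mult_nonpos_nonpos[of "exp a - 1" a]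
  by (cases "a \<ge> 0") (auto simp: algebra_simps)

lemma exp_mult_self_gt: "a > 0 \<Longrightarrow> exp a * a > (a::real)"
  using mult_strict_right_mono[of 1 "exp a" a] by simp

lemma sum_exp_mult_self_gt:
  fixes a :: "'v \<Rightarrow> real"
  assumes "finite A" "i \<in> A" "a i > 0"
  shows "(\<Sum>i\<in>A. exp (a i) * a i) > (\<Sum>i\<in>A. a i)"
  using assms by (intro sum_strict_mono_ex1) (auto intro: exp_mult_self_ge exp_mult_self_gt)

lemma sum_vector_matrix_mult:
  fixes W :: "real^'d^'k"
  shows "(\<Sum>i\<in>A. c i *\<^sub>R (x i v* W)) = (\<Sum>i\<in>A. c i *\<^sub>R x i) v* W"
proof -
  have "linear (\<lambda>v. v v* W)"
    using matrix_vector_mul_linear[of "transpose W"] by simp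
  then show ?thesis
    by (simp add: linear_sum[of "\<lambda>v. v v* W"] scaleR_vector_matrix_assoc)
qed

lemma exists_vector_matrix_mult_eq:
  fixes s :: "real^'k" and t :: "real^'d"
  assumes "s \<noteq> 0"
  obtains W :: "real^'d^'k" where "s v* W = t"
proof
  \<comment> \<open>The witness is the outer product of \<open>s\<close> and \<open>t\<close>,
    divided by \<open>s \<bullet> s\<close> to cancel the factor that multiplication by
    \<open>s\<close> produces.\<close>
  have "(s v* (\<chi> i j. s $ i * (t $ j / (s \<bullet> s)))) $ j = t $ j" for j
  proof -
    have "(s v* (\<chi> i j. s $ i * (t $ j / (s \<bullet> s)))) $ j =
        (\<Sum>i\<in>UNIV. s $ i * s $ i * (t $ j / (s \<bullet> s)))"
      by (simp only: vector_matrix_mult_def vec_lambda_beta mult.assoc)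
    also have "\<dots> = (s \<bullet> s) * (t $ j / (s \<bullet> s))"
      by (simp only: inner_vec_def inner_real_def sum_distrib_right)
    finally show ?thesis
      using assms by simp
  qed
  then show "s v* (\<chi> i j. s $ i * (t $ j / (s \<bullet> s))) = t"
    unfolding vec_eq_iff by blast
qed

text \<open>The denominator depends only on \<open>j\<close>, so it factors out and the numerator
  alone decides whether the inner product vanishes.\<close>

lemma sum_ssagg_coeff_inner:
  "(\<Sum>i | (i, j) \<in> parcs G. ssagg_coeff lam \<psi> G h i j *\<^sub>R h i) \<bullet> u =
     (\<Sum>i | (i, j) \<in> parcs G. exp (\<psi> (h i) (h j)) * (h i \<bullet> u)) /
       (exp lam + (\<Sum>k | (k, j) \<in> parcs G. exp (\<psi> (h k) (h j))))"
  by (simp add: ssagg_coeff_def ssagg_score_def inner_sum_left sum_divide_distrib)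

lemma ssagg_denominator_pos:
  "exp lam + (\<Sum>k | (k, j) \<in> parcs G. exp (\<psi> (h k) (h j))) > (0::real)"
  by (intro add_pos_nonneg sum_nonneg) auto

lemma exists_score_aggregate_nonzero:
  fixes h :: "'v \<Rightarrow> real^'k"
  assumes "finite (parcs G)" "(i, j) \<in> parcs G" "h i \<noteq> 0"
  obtains \<psi> where "(\<Sum>i | (i, j) \<in> parcs G. ssagg_coeff lam \<psi> G h i j *\<^sub>R h i) \<noteq> 0"
proof -
  have "finite {i. (i, j) \<in> parcs G}"
    using finite_imageI[OF assms(1), of fst] by (rule rev_finite_subset) force
  then have "(\<Sum>k | (k, j) \<in> parcs G. exp (h k \<bullet> h i) * (h k \<bullet> h i)) >
      (\<Sum>k | (k, j) \<in> parcs G. h k \<bullet> h i)"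
    using assms by (intro sum_exp_mult_self_gt[where i = i]) auto
  \<comment> \<open>Two distinct numbers are not both 0. The factor \<open>exp 0\<close> gives both
    cases the shape required of a score.\<close>
  then consider "(\<Sum>k | (k, j) \<in> parcs G. exp 0 * (h k \<bullet> h i)) \<noteq> 0"
    | "(\<Sum>k | (k, j) \<in> parcs G. exp (h k \<bullet> h i) * (h k \<bullet> h i)) \<noteq> 0"
    by (metis (no_types, lifting) exp_zero less_irrefl mult_1 sum.cong)
  then obtain \<psi> :: "real^'k \<Rightarrow> real^'k \<Rightarrow> real"
    where "(\<Sum>k | (k, j) \<in> parcs G. exp (\<psi> (h k) (h j)) * (h k \<bullet> h i)) \<noteq> 0"
  proof cases
    case 1
    then show ?thesis by (rule that[of "\<lambda>_ _. 0"])
  next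
    case 2
    \<comment> \<open>The score may mention \<open>h i\<close> because \<psi> is chosen after
      \<open>h\<close>.\<close>
    then show ?thesis by (rule that[of "\<lambda>x _. x \<bullet> h i"])
  qed
  then have "(\<Sum>k | (k, j) \<in> parcs G. ssagg_coeff lam \<psi> G h k j *\<^sub>R h k) \<bullet> h i \<noteq> 0"
    using ssagg_denominator_pos[of lam \<psi> h j G] by (simp add: sum_ssagg_coeff_inner)
  then show ?thesis
    by (intro that[of \<psi>]) auto
qed

text \<open>If all children of \<open>r\<close> carried the zero vector, the output would be 0 for
  every \<theta>, whereas \<open>gnn_pool f\<close> may return a nonzero vector;
  \<open>nondegenerate\<close> excludes this.\<close>

theorem proposition2:
  fixes G G' :: "'v pair_pre_digraph"
    and r :: 'v
    and h :: "'v \<Rightarrow> real^'k"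
    and lam :: real
    and f :: "('k, 'h, 'm, 'd::finite) gnn"
  assumes "original_graph G r"
    and "hyper_structure_graph G G'"
    and nondegenerate: "\<exists>i. (i, r) \<in> parcs G \<and> h i \<noteq> 0"
  shows "\<exists>\<theta> :: (real^'k \<Rightarrow> real^'k \<Rightarrow> real) \<times> (real^'d^'k).
           SSAgg lam \<theta> G h r = gnn_encode f G' h"
proof -
  interpret pair_digraph G
    using assms(1) by (simp add: original_graph_def)
  obtain i where "(i, r) \<in> parcs G" "h i \<noteq> 0"
    using nondegenerate by blast
  then obtain \<psi> where "(\<Sum>i | (i, r) \<in> parcs G. ssagg_coeff lam \<psi> G h i r *\<^sub>R h i) \<noteq> 0"
    by (rule exists_score_aggregate_nonzero[OF pair_finite_arcs])
  then obtain W :: "real^'d^'k" where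
    "(\<Sum>i | (i, r) \<in> parcs G. ssagg_coeff lam \<psi> G h i r *\<^sub>R h i) v* W = gnn_encode f G' h"
    by (rule exists_vector_matrix_mult_eq)
  then have "SSAgg lam (\<psi>, W) G h r = gnn_encode f G' h"
    by (simp add: SSAgg_def ssagg_node_def sum_vector_matrix_mult)
  then show ?thesis ..
qed

end
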